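(* Let $d\ge1$ and let $f:[0,\infty)\times\mathbb{R}^d\to\mathbb{R}$ be such that $f(t,\cdot)$ is $\mathcal{C}^1$ for every $t\ge 0$ and the gradient $\nabla f(t,q)$ with respect to $q$ is jointly continuous in $(t,q)$. Given $m>0$ and $\sigma>0$, let $$r_\star=\frac{3\sigma+\sqrt{2m+\sigma^2}}{2},\qquad \tau_\star=\frac{\sigma+\sqrt{2m+\sigma^2}}{m}.$$ If $q\mapsto\nabla f(t,q)$ belongs to the sector $[m,\infty]$ for all $t\ge0$, then the system $$\dot q=p-\tau_\star\nabla f(t,q),\qquad \dot p=-2\sigma p-\nabla f(t,q)$$ on $\mathbb{R}^{2d}\ni z=(q,p)$ is $r_\star$-exponentially stable.
   Context: Sector: a continuous function $\phi:\mathbb{R}^n\to\mathbb{R}^n$ belongs to the sector $[m,\infty]$ if $\langle mw-\phi(w),\,w\rangle\le 0$ for all $w\in\mathbb{R}^n$. Exponential stability: a system $\dot z=F(t,z)$, $t\ge0$, with $F$ continuous is $r$-exponentially stable ($r\ge0$) if $z=0$ is an equilibrium point and there is an increasing continuous function $\kappa:[0,\infty)\to[0,\infty)$ with $\kappa(0)=0$ such that $|z(t)|\le\kappa(|z(0)|)\,e^{-rt}$ for each solution $z$ (starting at time $0$) and every $t\ge0$ for which $z$ exists. *)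

theory Defs
  imports "HOL-Analysis.Analysis"
begin

definition in_sector :: "real \<Rightarrow> ('a::real_inner \<Rightarrow> 'a) \<Rightarrow> bool" where
  "in_sector m \<phi> \<longleftrightarrow>
     continuous_on UNIV \<phi> \<and> (\<forall>w. (m *\<^sub>R w - \<phi> w) \<bullet> w \<le> 0)"

text \<open>Solutions of \<open>z' = F(t, z)\<close> starting at time \<open>0\<close> live on an arbitrary nondegenerate interval
  \<open>J\<close> with left endpoint \<open>0\<close> (bounded or not, open or closed on the right, not necessarily
  maximal); at \<open>0\<close>, and at a right endpoint of \<open>J\<close>, the derivative is one-sided.\<close>

definition solves_from_0 ::
    "(real \<Rightarrow> 'a \<Rightarrow> 'a::real_normed_vector) \<Rightarrow> real set \<Rightarrow> (real \<Rightarrow> 'a) \<Rightarrow> bool" where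
  "solves_from_0 F J z \<longleftrightarrow>
     is_interval J \<and> 0 \<in> J \<and> J \<subseteq> {0..} \<and> J \<noteq> {0} \<and>
     (\<forall>t\<in>J. (z has_vector_derivative F t (z t)) (at t within J))"

text \<open>Only the values of \<open>F\<close> at times \<open>t \<ge> 0\<close> and of \<open>\<kappa>\<close> on \<open>[0,\<infinity>)\<close> matter. ``Increasing'' is read
  as strictly increasing; by adding \<open>s\<close> to \<open>\<kappa>(s)\<close> the weak reading yields the same notion.\<close>

definition exp_stable ::
    "real \<Rightarrow> (real \<Rightarrow> 'a \<Rightarrow> 'a::real_normed_vector) \<Rightarrow> bool" where
  "exp_stable r F \<longleftrightarrow>
     r \<ge> 0 \<and>
     continuous_on ({0..} \<times> UNIV) (\<lambda>(t, z). F t z) \<and>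
     (\<forall>t\<ge>0. F t 0 = 0) \<and>
     (\<exists>\<kappa>::real \<Rightarrow> real.
        \<kappa> ` {0..} \<subseteq> {0..} \<and> continuous_on {0..} \<kappa> \<and> strict_mono_on {0..} \<kappa> \<and> \<kappa> 0 = 0 \<and>
        (\<forall>J z. solves_from_0 F J z \<longrightarrow>
           (\<forall>t\<in>J. norm (z t) \<le> \<kappa> (norm (z 0)) * exp (- r * t))))"

definition r_star :: "real \<Rightarrow> real \<Rightarrow> real" where
  "r_star m \<sigma> = (3 * \<sigma> + sqrt (2 * m + \<sigma>\<^sup>2)) / 2"

definition tau_star :: "real \<Rightarrow> real \<Rightarrow> real" where
  "tau_star m \<sigma> = (\<sigma> + sqrt (2 * m + \<sigma>\<^sup>2)) / m"

end

theory Submission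
  imports Defs
begin

text \<open>The Lyapunov function is \<open>V(q,p) = m \<tau> |q|\<^sup>2 - 2 q \<bullet> p + \<tau> |p|\<^sup>2\<close> with \<open>\<tau> = \<tau>\<^sub>\<star>\<close>. Its mixed
  coefficient is chosen so that \<open>\<nabla>f\<close> enters \<open>V'\<close> only through \<open>q \<bullet> \<nabla>f\<close>, and the remaining ones so
  that \<open>V' = - 2 r\<^sub>\<star> V\<close> exactly when \<open>\<nabla>f = m q\<close> (that linear system has the eigenvalues
  \<open>- r\<^sub>\<star> \<plusminus> i \<omega>\<close>). In general
  \<open>V' = - 2 r\<^sub>\<star> V - 2 (m \<tau>\<^sup>2 - 1) (q \<bullet> \<nabla>f - m |q|\<^sup>2)\<close>, where \<open>m \<tau>\<^sup>2 > 2\<close> makes \<open>V\<close> positive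
  definite and the last term nonpositive on the sector.\<close>

text \<open>Testing the sector inequality at \<open>e *\<^sub>R v\<close> with
  \<open>v = - \<phi> 0\<close> and dividing by \<open>e > 0\<close> gives a bound that survives
  \<open>e\<close> tending to 0: by continuity \<open>- \<phi> 0 \<bullet> v\<close>, that is
  \<open>\<phi> 0 \<bullet> \<phi> 0\<close>, is at most 0. This is what makes the origin an
  equilibrium.\<close>

lemma in_sector_zero:
  assumes "in_sector m \<phi>"
  shows "\<phi> 0 = 0"
proof -
  define v where "v = - \<phi> 0"
  have cont: "continuous_on UNIV \<phi>"
    and sec: "\<And>w. (m *\<^sub>R w - \<phi> w) \<bullet> w \<le> 0"
    using assms by (auto simp: in_sector_def)
  have ev: "eventually (\<lambda>e. (m * e) * (v \<bullet> v) - \<phi> (e *\<^sub>R v) \<bullet> v \<le> 0) (at_right (0::real))"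
  proof (rule eventually_at_right_less[THEN eventually_mono])
    fix e :: real assume "0 < e"
    have "e * ((m * e) * (v \<bullet> v) - \<phi> (e *\<^sub>R v) \<bullet> v) \<le> 0"
      using sec[of "e *\<^sub>R v"] by (simp add: inner_diff_left algebra_simps)
    with \<open>0 < e\<close> show "(m * e) * (v \<bullet> v) - \<phi> (e *\<^sub>R v) \<bullet> v \<le> 0"
      by (simp add: mult_le_0_iff)
  qed
  have lim_phi: "((\<lambda>e. \<phi> (e *\<^sub>R v)) \<longlongrightarrow> \<phi> (0 *\<^sub>R v)) (at_right (0::real))"
    using cont by (intro continuous_on_tendsto_compose[of UNIV \<phi>] tendsto_intros) auto
  have "((\<lambda>e. (m * e) * (v \<bullet> v) - \<phi> (e *\<^sub>R v) \<bullet> v) \<longlongrightarrow> (m * 0) * (v \<bullet> v) - \<phi> (0 *\<^sub>R v) \<bullet> v)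
      (at_right (0::real))"
    by (intro tendsto_intros lim_phi)
  from tendsto_upperbound[OF this ev] have "\<phi> 0 \<bullet> \<phi> 0 \<le> 0"
    by (simp add: v_def)
  then show ?thesis
    by (metis inner_eq_zero_iff inner_ge_zero order_antisym)
qed

text \<open>With the integrating factor \<open>exp (c * s)\<close>, the product \<open>W\<close> has
  derivative \<open>exp (c * s) * (V' s + c * V s) \<le> 0\<close>, so the mean value theorem gives
  \<open>W t \<le> W 0\<close>. Derivatives within \<open>{0..t}\<close> fit solutions whose
  interval ends at \<open>t\<close>.\<close>

lemma exp_decay_of_differential_inequality:
  fixes V V' :: "real \<Rightarrow> real"
  assumes "0 \<le> t"
    and deriv: "\<And>s. s \<in> {0..t} \<Longrightarrow> (V has_vector_derivative V' s) (at s within {0..t})"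
    and ineq: "\<And>s. s \<in> {0..t} \<Longrightarrow> V' s \<le> - c * V s"
  shows "V t \<le> V 0 * exp (- c * t)"
proof -
  define W where "W = (\<lambda>s. exp (c * s) * V s)"
  have W: "(W has_derivative (\<lambda>h. h * (exp (c * s) * (V' s + c * V s)))) (at s within {0..t})"
    if "s \<in> {0..t}" for s
  proof -
    have "(V has_real_derivative V' s) (at s within {0..t})"
      using deriv[OF that] by (simp add: has_real_derivative_iff_has_vector_derivative)
    then have "(W has_real_derivative exp (c * s) * (V' s + c * V s)) (at s within {0..t})"
      unfolding W_def by (auto intro!: derivative_eq_intros simp: algebra_simps)
    then show ?thesis
      by (simp add: has_field_derivative_def mult.commute[of _ "exp (c * s) * (V' s + c * V s)"])
  qed
  have "\<exists>s\<in>{0..t}. W t - W 0 = (t - 0) * (exp (c * s) * (V' s + c * V s))"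
    by (rule mvt_very_simple[OF \<open>0 \<le> t\<close>]) (rule W, simp)
  then obtain s where s: "s \<in> {0..t}"
      and "W t - W 0 = (t - 0) * (exp (c * s) * (V' s + c * V s))" ..
  moreover have "(t - 0) * (exp (c * s) * (V' s + c * V s)) \<le> 0"
    using ineq[OF s] \<open>0 \<le> t\<close> by (intro mult_nonneg_nonpos) auto
  ultimately have "exp (c * t) * V t \<le> V 0"
    by (simp add: W_def)
  then show ?thesis
    by (simp add: exp_minus field_simps)
qed

lemma norm_Pair_power2: "(norm (x, y))\<^sup>2 = (norm x)\<^sup>2 + (norm y)\<^sup>2"
  by (simp add: norm_Pair)

definition lyapunov :: "real \<Rightarrow> real \<Rightarrow> 'a::real_inner \<times> 'a \<Rightarrow> real" where
  "lyapunov m \<tau> = (\<lambda>(q, p). m * \<tau> * (q \<bullet> q) - 2 * (q \<bullet> p) + \<tau> * (p \<bullet> p))"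

lemma lyapunov_le_norm:
  fixes z :: "'a::real_inner \<times> 'a"
  assumes "0 < m" "0 < \<tau>"
  shows "lyapunov m \<tau> z \<le> (m * \<tau> + \<tau> + 1) * (norm z)\<^sup>2"
proof -
  obtain q p where z: "z = (q, p)" by fastforce
  \<comment> \<open>The right side minus the left side of the claim is exactly \<open>(q + p)
    \<bullet> (q + p) + \<tau> * (q \<bullet> q) + m * \<tau> * (p \<bullet> p)\<close>.\<close>
  have "0 \<le> (q + p) \<bullet> (q + p)" by simp
  then have "- 2 * (q \<bullet> p) \<le> q \<bullet> q + p \<bullet> p"
    by (simp add: inner_add_left inner_add_right inner_commute)
  moreover have "0 \<le> \<tau> * (q \<bullet> q)" "0 \<le> m * \<tau> * (p \<bullet> p)"
    using assms by auto
  ultimately show ?thesis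
    by (simp add: z lyapunov_def norm_Pair_power2 power2_norm_eq_inner algebra_simps)
qed

text \<open>Half of the \<open>q \<bullet> q\<close> term is kept; the other half absorbs the whole
  mixed term by completing the square. This costs \<open>2 / (m * \<tau>)\<close> of the
  \<open>p \<bullet> p\<close> coefficient, and what remains is positive because
  \<open>m * \<tau>\<^sup>2 > 2\<close>.\<close>

lemma norm_le_lyapunov:
  fixes z :: "'a::real_inner \<times> 'a"
  assumes "0 < m" "0 < \<tau>" "2 < m * \<tau>\<^sup>2"
  shows "min (m * \<tau> / 2) (\<tau> - 2 / (m * \<tau>)) * (norm z)\<^sup>2 \<le> lyapunov m \<tau> z"
proof -
  obtain q p where z: "z = (q, p)" by fastforce
  have pos: "0 < m * \<tau>" using assms by simp
  define c where "c = min (m * \<tau> / 2) (\<tau> - 2 / (m * \<tau>))"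
  have "0 \<le> (m * \<tau> / 2) * ((q - (2 / (m * \<tau>)) *\<^sub>R p) \<bullet> (q - (2 / (m * \<tau>)) *\<^sub>R p))"
    using pos by simp
  also have "\<dots> = (m * \<tau> / 2) * (q \<bullet> q) - 2 * (q \<bullet> p) + 2 / (m * \<tau>) * (p \<bullet> p)"
    using assms by (simp add: inner_diff_left inner_diff_right inner_commute field_simps)
  finally have "(m * \<tau> / 2) * (q \<bullet> q) + (\<tau> - 2 / (m * \<tau>)) * (p \<bullet> p) \<le> lyapunov m \<tau> z"
    by (simp add: z lyapunov_def algebra_simps)
  moreover have "c * (q \<bullet> q) \<le> (m * \<tau> / 2) * (q \<bullet> q)" "c * (p \<bullet> p) \<le> (\<tau> - 2 / (m * \<tau>)) * (p \<bullet> p)"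
    unfolding c_def by (intro mult_right_mono min.cobounded1 min.cobounded2 inner_ge_zero)+
  ultimately show ?thesis
    unfolding c_def[symmetric] by (simp add: z norm_Pair_power2 power2_norm_eq_inner algebra_simps)
qed

lemma lyapunov_has_vector_derivative:
  fixes q p :: "real \<Rightarrow> 'a::real_inner"
  assumes "(q has_vector_derivative q') (at t within S)"
    and "(p has_vector_derivative p') (at t within S)"
  shows "((\<lambda>s. lyapunov m \<tau> (q s, p s)) has_vector_derivative
    2 * (m * \<tau>) * (q t \<bullet> q') - 2 * (q t \<bullet> p' + q' \<bullet> p t) + 2 * \<tau> * (p t \<bullet> p')) (at t within S)"
  unfolding lyapunov_def has_vector_derivative_def
  by (auto intro!: derivative_eq_intros assms[unfolded has_vector_derivative_def]
      simp: algebra_simps inner_commute)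

text \<open>\<open>tau_star m \<sigma>\<close> is the positive root of
  \<open>m * \<tau>\<^sup>2 = 2 * \<sigma> * \<tau> + 2\<close>. Hence
  \<open>2 * \<sigma> + 1 / \<tau>\<close> and \<open>m * \<tau> - 1 / \<tau>\<close> agree, and
  their common value is the rate. The two expressions come from matching the
  \<open>p \<bullet> p\<close> and \<open>q \<bullet> q\<close> coefficients in the Lyapunov
  identity.\<close>

lemma star_identities:
  assumes "0 < m" "0 < \<sigma>"
  shows "0 < tau_star m \<sigma>"
    and "2 < m * (tau_star m \<sigma>)\<^sup>2"
    and "tau_star m \<sigma> * r_star m \<sigma> = 2 * \<sigma> * tau_star m \<sigma> + 1"
    and "r_star m \<sigma> = m * tau_star m \<sigma> - 1 / tau_star m \<sigma>"
proof -
  define s where "s = sqrt (2 * m + \<sigma>\<^sup>2)"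
  have s2: "s\<^sup>2 = 2 * m + \<sigma>\<^sup>2" using assms by (simp add: s_def)
  have "\<sigma> < s" unfolding s_def using assms by (intro real_less_rsqrt) auto
  have tau: "tau_star m \<sigma> = (\<sigma> + s) / m" and r: "r_star m \<sigma> = (3 * \<sigma> + s) / 2"
    by (simp_all add: tau_star_def r_star_def s_def)
  show pos: "0 < tau_star m \<sigma>" using assms \<open>\<sigma> < s\<close> by (simp add: tau)
  have "2 * m < (\<sigma> + s)\<^sup>2"
    using assms \<open>\<sigma> < s\<close> s2 by (simp add: power2_sum add_pos_pos)
  moreover have "m * (tau_star m \<sigma>)\<^sup>2 = (\<sigma> + s)\<^sup>2 / m"
    using assms by (simp add: tau power2_eq_square)
  ultimately show "2 < m * (tau_star m \<sigma>)\<^sup>2"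
    using assms by (simp add: less_divide_eq)
  \<comment> \<open>Behind this is \<open>(s + \<sigma>) * (s - \<sigma>) = 2 * m\<close>, so that
    \<open>1 / \<tau> = (s - \<sigma>) / 2\<close>.\<close>
  show tr: "tau_star m \<sigma> * r_star m \<sigma> = 2 * \<sigma> * tau_star m \<sigma> + 1"
    using assms s2 by (simp add: tau r power2_eq_square field_simps)
  have "m * tau_star m \<sigma> = \<sigma> + s" using assms by (simp add: tau)
  moreover have "1 / tau_star m \<sigma> = r_star m \<sigma> - 2 * \<sigma>"
    using tr pos by (simp add: field_simps)
  ultimately show "r_star m \<sigma> = m * tau_star m \<sigma> - 1 / tau_star m \<sigma>"
    by (simp add: r field_simps)
qed

lemma lyapunov_derivative_le:
  fixes q p g :: "'a::real_inner"
  assumes "0 < m" "0 < \<sigma>"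
    and sector: "(m *\<^sub>R q - g) \<bullet> q \<le> 0"
  defines "\<tau> \<equiv> tau_star m \<sigma>"
  defines "q' \<equiv> p - \<tau> *\<^sub>R g" and "p' \<equiv> - (2 * \<sigma>) *\<^sub>R p - g"
  shows "2 * (m * \<tau>) * (q \<bullet> q') - 2 * (q \<bullet> p' + q' \<bullet> p) + 2 * \<tau> * (p \<bullet> p')
    \<le> - (2 * r_star m \<sigma>) * lyapunov m \<tau> (q, p)" (is "?D \<le> _")
proof -
  define r where "r = r_star m \<sigma>"
  define Q X P where "Q = q \<bullet> q" and "X = q \<bullet> p" and "P = p \<bullet> p"
  define Y Z where "Y = q \<bullet> g" and "Z = p \<bullet> g"
  note defs = Q_def X_def P_def Y_def Z_def
  have \<tau>: "0 < \<tau>" and m\<tau>: "2 < m * \<tau>\<^sup>2"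
    and r1: "\<tau> * r = 2 * \<sigma> * \<tau> + 1" and "r = m * \<tau> - 1 / \<tau>"
    using star_identities[OF assms(1,2)] by (simp_all add: \<tau>_def r_def)
  then have r2: "\<tau> * r = m * \<tau>\<^sup>2 - 1"
    by (simp add: field_simps power2_eq_square)
  \<comment> \<open>The two \<open>Z\<close> terms, \<open>2 * \<tau> * Z\<close> and
    \<open>- 2 * \<tau> * Z\<close>, cancel: \<open>p \<bullet> g\<close>, on which the sector gives
    no control, drops out.\<close>
  have D: "?D = 2 * (m * \<tau>) * (X - \<tau> * Y) - 2 * (- 2 * \<sigma> * X - Y + (P - \<tau> * Z))
      + 2 * \<tau> * (- 2 * \<sigma> * P - Z)"
    by (simp add: q'_def p'_def defs inner_diff_left inner_diff_right inner_commute algebra_simps)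
  have V: "lyapunov m \<tau> (q, p) = m * \<tau> * Q - 2 * X + \<tau> * P"
    by (simp add: lyapunov_def defs)
  \<comment> \<open>The factor \<open>m * \<tau>\<^sup>2 - 1\<close> is forced by cancelling
    \<open>Y\<close>; the brackets on the right collect the leftover coefficients of
    \<open>Q\<close>, \<open>P\<close> and \<open>X\<close>.\<close>
  have "?D + 2 * r * lyapunov m \<tau> (q, p) + 2 * (m * \<tau>\<^sup>2 - 1) * (Y - m * Q)
    = 2 * m * Q * (\<tau> * r - (m * \<tau>\<^sup>2 - 1)) + 2 * P * (\<tau> * r - (2 * \<sigma> * \<tau> + 1))
      + 2 * X * (m * \<tau> + 2 * \<sigma> - 2 * r)"
    unfolding D V by (simp add: algebra_simps power2_eq_square)
  also have "m * \<tau> + 2 * \<sigma> - 2 * r = 0"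
  proof -
    \<comment> \<open>The condition on \<open>X\<close> is the sum of \<open>r1\<close> and
      \<open>r2\<close>, divided by \<open>\<tau>\<close>.\<close>
    have "\<tau> * (m * \<tau> + 2 * \<sigma> - 2 * r) = 0"
      using r1 r2 by (simp add: algebra_simps power2_eq_square)
    with \<tau> show ?thesis by simp
  qed
  also have "\<tau> * r - (m * \<tau>\<^sup>2 - 1) = 0"
    using r2 by simp
  also have "\<tau> * r - (2 * \<sigma> * \<tau> + 1) = 0"
    using r1 by simp
  finally have eq: "?D + 2 * r * lyapunov m \<tau> (q, p) + 2 * (m * \<tau>\<^sup>2 - 1) * (Y - m * Q) = 0"
    by simp
  have "0 \<le> Y - m * Q"
    using sector by (simp add: defs inner_diff_left inner_commute[of q g])
  then have "0 \<le> 2 * (m * \<tau>\<^sup>2 - 1) * (Y - m * Q)"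
    using m\<tau> by (intro mult_nonneg_nonneg) auto
  with eq show ?thesis
    unfolding r_def by linarith
qed

theorem theorem5:
  fixes f :: "real \<Rightarrow> real ^ 'd \<Rightarrow> real"
    and grad :: "real \<Rightarrow> real ^ 'd \<Rightarrow> real ^ 'd"
    and m \<sigma> :: real
  assumes gradient: "\<And>t q. t \<ge> 0 \<Longrightarrow> GDERIV (f t) q :> grad t q"
    and C1: "\<And>t. t \<ge> 0 \<Longrightarrow> continuous_on UNIV (grad t)"
    and joint: "continuous_on ({0..} \<times> UNIV) (\<lambda>(t, q). grad t q)"
    and "m > 0" and "\<sigma> > 0"
    and sector: "\<And>t. t \<ge> 0 \<Longrightarrow> in_sector m (grad t)"
  shows "exp_stable (r_star m \<sigma>)
           (\<lambda>t (q, p). (p - tau_star m \<sigma> *\<^sub>R grad t q, - (2 * \<sigma>) *\<^sub>R p - grad t q))"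
proof -
  define \<tau> r where "\<tau> = tau_star m \<sigma>" and "r = r_star m \<sigma>"
  define F where "F = (\<lambda>t (q, p). (p - \<tau> *\<^sub>R grad t q, - (2 * \<sigma>) *\<^sub>R p - grad t q))"
  \<comment> \<open>These are the lower and upper constants comparing the Lyapunov function with the
    squared norm; the square root of their ratio yields a linear \<open>\<kappa>\<close>.\<close>
  define c C where "c = min (m * \<tau> / 2) (\<tau> - 2 / (m * \<tau>))" and "C = m * \<tau> + \<tau> + 1"
  define \<kappa> where "\<kappa> = (\<lambda>s::real. sqrt (C / c) * s)"
  have \<tau>: "0 < \<tau>" and m\<tau>: "2 < m * \<tau>\<^sup>2"
    using star_identities[OF \<open>m > 0\<close> \<open>\<sigma> > 0\<close>] by (simp_all add: \<tau>_def)
  have "0 < c" and "0 < C"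
    using \<open>m > 0\<close> \<tau> m\<tau> by (auto simp: c_def C_def field_simps power2_eq_square add_pos_pos)
  have "0 \<le> r"
    using \<open>m > 0\<close> \<open>\<sigma> > 0\<close> by (simp add: r_def r_star_def)
  have "continuous_on ({0..} \<times> UNIV) (\<lambda>x. grad (fst x) (fst (snd x)))"
    by (rule continuous_on_compose2[OF joint, of _ "\<lambda>x. (fst x, fst (snd x))", simplified])
      (auto intro!: continuous_intros)
  then have cont: "continuous_on ({0..} \<times> UNIV) (\<lambda>(t, z). F t z)"
    unfolding F_def case_prod_beta by (intro continuous_intros)
  have zero: "F t 0 = 0" if "0 \<le> t" for t
    using in_sector_zero[OF sector[OF that]] by (simp add: F_def zero_prod_def)
  have decay: "norm (z t) \<le> \<kappa> (norm (z 0)) * exp (- r * t)"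
    if sol: "solves_from_0 F J z" and "t \<in> J" for J z t
  proof -
    define q p where "q = (\<lambda>s. fst (z s))" and "p = (\<lambda>s. snd (z s))"
    have z: "z = (\<lambda>s. (q s, p s))"
      by (simp add: q_def p_def)
    have J: "is_interval J" "0 \<in> J" "0 \<le> t"
      and deriv: "\<And>s. s \<in> J \<Longrightarrow> (z has_vector_derivative F s (z s)) (at s within J)"
      using sol \<open>t \<in> J\<close> by (auto simp: solves_from_0_def)
    \<comment> \<open>Whatever the shape of \<open>J\<close>, the solution restricts to the compact
      interval on which the decay lemma applies.\<close>
    have sub: "{0..t} \<subseteq> J"
      using mem_is_interval_1_I[OF J(1,2) \<open>t \<in> J\<close>] by auto
    have dq: "(q has_vector_derivative p s - \<tau> *\<^sub>R grad s (q s)) (at s within {0..t})"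
      and dp: "(p has_vector_derivative - (2 * \<sigma>) *\<^sub>R p s - grad s (q s)) (at s within {0..t})"
      if "s \<in> {0..t}" for s
    proof -
      have "(z has_vector_derivative F s (z s)) (at s within {0..t})"
        using deriv that sub has_vector_derivative_within_subset by blast
      from bounded_linear.has_vector_derivative[OF bounded_linear_fst this]
        bounded_linear.has_vector_derivative[OF bounded_linear_snd this]
      show "(q has_vector_derivative p s - \<tau> *\<^sub>R grad s (q s)) (at s within {0..t})"
        and "(p has_vector_derivative - (2 * \<sigma>) *\<^sub>R p s - grad s (q s)) (at s within {0..t})"
        by (simp_all add: F_def q_def p_def case_prod_beta)
    qed
    have sec: "(m *\<^sub>R q s - grad s (q s)) \<bullet> q s \<le> 0" if "s \<in> {0..t}" for s
      using sector[of s] that by (simp add: in_sector_def)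
    have "lyapunov m \<tau> (q t, p t) \<le> lyapunov m \<tau> (q 0, p 0) * exp (- (2 * r) * t)"
      unfolding \<tau>_def r_def
      by (rule exp_decay_of_differential_inequality[OF \<open>0 \<le> t\<close>
            lyapunov_has_vector_derivative[OF dq dp, unfolded \<tau>_def]
            lyapunov_derivative_le[OF \<open>m > 0\<close> \<open>\<sigma> > 0\<close> sec]])
    also have "\<dots> \<le> C * (norm (z 0))\<^sup>2 * exp (- (2 * r) * t)"
      using lyapunov_le_norm[OF \<open>m > 0\<close> \<tau>, of "z 0"]
      by (intro mult_right_mono) (auto simp: C_def z)
    finally have "c * (norm (z t))\<^sup>2 \<le> C * (norm (z 0))\<^sup>2 * exp (- (2 * r) * t)"
      using norm_le_lyapunov[OF \<open>m > 0\<close> \<tau> m\<tau>, of "z t"] by (simp add: c_def z)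
    \<comment> \<open>The Lyapunov function is quadratic, so its decay rate \<open>2 * r\<close> is
      rate \<open>r\<close> for the norm.\<close>
    also have "exp (- (2 * r) * t) = (exp (- r * t))\<^sup>2"
      by (simp add: exp_double[symmetric] mult.assoc)
    finally have "(norm (z t))\<^sup>2 \<le> C / c * (norm (z 0))\<^sup>2 * (exp (- r * t))\<^sup>2"
      using \<open>0 < c\<close> by (simp add: field_simps)
    also have "\<dots> = (\<kappa> (norm (z 0)) * exp (- r * t))\<^sup>2"
      using \<open>0 < c\<close> \<open>0 < C\<close> by (simp add: \<kappa>_def power_mult_distrib)
    finally show ?thesis
      by (rule power2_le_imp_le) (use \<open>0 < c\<close> \<open>0 < C\<close> in \<open>simp add: \<kappa>_def\<close>)
  qed
  have "\<kappa> ` {0..} \<subseteq> {0..}" "continuous_on {0..} \<kappa>" "strict_mono_on {0..} \<kappa>" "\<kappa> 0 = 0"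
    using \<open>0 < c\<close> \<open>0 < C\<close>
    by (auto simp: \<kappa>_def intro!: continuous_intros strict_mono_onI mult_strict_left_mono)
  with \<open>0 \<le> r\<close> cont zero decay have "exp_stable r F"
    unfolding exp_stable_def by blast
  then show ?thesis
    by (simp add: F_def r_def \<tau>_def)
qed

end
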